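(* Let $F$ be a field of characteristic $0$ and let $n$ be an odd positive integer. Let $s_n=n\times\langle1\rangle$ be the sum-of-squares form $x_1^2+\dots+x_n^2$ on $F^n$. Then $$\omega(\mathcal G_{s_n,1})=\begin{cases}n-1,&\text{if }n\notin D_F(\langle1,2(n-1)\rangle),\\ n,&\text{if }n\in D_F(\langle1,2(n-1)\rangle)\text{ and }2(n+1)\notin F^{\ast2},\\ n+1,&\text{if }n\in D_F(\langle1,2(n-1)\rangle)\text{ and }2(n+1)\in F^{\ast2}.\end{cases}$$
   Context: For a quadratic form $q$ on an $F$-vector space $V$ and $a\in F$, $\mathcal G_{q,a}$ is the graph with vertex set $V$ and edge set $\{\{x,y\}\mid x\ne y,\ q(x-y)=a\}$; $\omega$ denotes the clique number (size of a largest clique). $\langle a_1,\dots,a_m\rangle$ denotes the diagonal form $\sum a_ix_i^2$, $D_F(\varphi)$ is the set of nonzero elements of $F$ represented by $\varphi$, and $F^{\ast2}$ is the set of nonzero squares in $F$. *)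

theory Defs
  imports
    Jordan_Normal_Form.Matrix
    "HOL-Library.Ramsey"
    "HOL-Library.Extended_Nat"
begin

text \<open>A simple graph is a pair of a vertex set and a set of two-element edges.\<close>

type_synonym 'v sgraph = "'v set \<times> 'v set set"

text \<open>The graph \<open>G(q,a)\<close> of a form \<open>q\<close> on the vector space with carrier \<open>V\<close>.\<close>

definition form_graph :: "'v::minus set \<Rightarrow> ('v \<Rightarrow> 'a) \<Rightarrow> 'a \<Rightarrow> 'v sgraph" where
  "form_graph V q a = (V, {{x, y} | x y. x \<in> V \<and> y \<in> V \<and> x \<noteq> y \<and> q (x - y) = a})"

text \<open>
  The graphs are usually infinite, so the clique number is an extended natural number;
  \<open>card\<close> cannot be used alone since it is 0 on infinite sets. A supremum in
  \<open>enat\<close> equal to a finite value is attained, by a finite clique of that size.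
\<close>

definition clique_number :: "'v sgraph \<Rightarrow> enat" where
  "clique_number G =
     (SUP C \<in> {C. C \<subseteq> fst G \<and> clique C (snd G)}. if finite C then enat (card C) else \<infinity>)"

text \<open>
  The diagonal form with coefficient list \<open>as\<close>, a function on the vectors of dimension
  \<open>length as\<close>.
\<close>

definition diag_form :: "'a::field list \<Rightarrow> 'a vec \<Rightarrow> 'a" where
  "diag_form as v = (\<Sum>i<length as. as ! i * (v $ i)\<^sup>2)"

definition sum_of_squares_form :: "nat \<Rightarrow> 'a::field vec \<Rightarrow> 'a" where
  "sum_of_squares_form n = diag_form (replicate n 1)"

text \<open>\<open>D(\<phi>)\<close> for the diagonal form \<open>\<phi>\<close> with coefficient list \<open>as\<close>.\<close>

definition represented :: "'a::field list \<Rightarrow> 'a set" where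
  "represented as = diag_form as ` carrier_vec (length as) - {0}"

definition nonzero_squares :: "'a::field set" where
  "nonzero_squares = {b\<^sup>2 | b. b \<noteq> 0}"

end

theory Submission
  imports Defs Jordan_Normal_Form.Determinant
begin

text \<open>
  A clique with \<open>m + 1\<close> elements gives \<open>m\<close> vectors with Gram matrix \<open>(I + J)/2\<close>, whose
  determinant \<open>(m + 1)/2\<^sup>m\<close> is nonzero. So \<open>m \<le> n\<close>, and \<open>m = n\<close> forces \<open>2(n + 1)\<close> to be a
  square. Conversely, an \<open>n\<close>-clique has a normal vector whose length is \<open>n\<close> up to squares, and
  if \<open>2(n + 1)\<close> is a square, a multiple of it leads from the centroid to another point of a
  clique. As \<open>n - 1\<close> is even, the form \<open>(n - 1) \<times> \<langle>1\<rangle>\<close> is similar to itself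
  with factor 2, which shrinks the unit vectors to an \<open>(n - 1)\<close>-clique and also transforms the
  Gram form of an \<open>n\<close>-clique into \<open>(n - 1) \<times> \<langle>1\<rangle>\<close> plus half a square. Cancelling
  \<open>(n - 1) \<times> \<langle>1\<rangle>\<close> shows that an \<open>n\<close>-clique forces \<open>n = a\<^sup>2 - 2b\<^sup>2\<close> for some
  \<open>a\<close>, \<open>b\<close>, which is equivalent to \<open>n\<close> being represented by \<open>\<langle>1, 2(n - 1)\<rangle>\<close>.
\<close>

section \<open>Determinants of Gram matrices\<close>

text \<open>The products \<open>?P * ?Q\<close> and \<open>?Q * ?P\<close> are both block upper
  triangular, with \<open>1 + A * B\<close> and \<open>1 + B * A\<close> as the diagonal block that
  is not an identity.\<close>

lemma sylvester_det:
  fixes A B :: "'a::field mat"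
  assumes A: "A \<in> carrier_mat n m" and B: "B \<in> carrier_mat m n"
  shows "det (1\<^sub>m n + A * B) = det (1\<^sub>m m + B * A)"
proof -
  let ?P = "four_block_mat (1\<^sub>m n) A (- B) (1\<^sub>m m)"
  let ?Q = "four_block_mat (1\<^sub>m n) (0\<^sub>m n m) B (1\<^sub>m m)"
  have P: "?P \<in> carrier_mat (n + m) (n + m)" and Q: "?Q \<in> carrier_mat (n + m) (n + m)"
    by auto
  have "?P * ?Q = four_block_mat (1\<^sub>m n + A * B) A (0\<^sub>m m n) (1\<^sub>m m)"
    using A B by (subst mult_four_block_mat[where ?n1.0 = n and ?n2.0 = m]) auto
  then have "det (?P * ?Q) = det (1\<^sub>m n + A * B)"
    using A B by (simp add: det_four_block_mat_lower_left_zero[where n = n and m = m])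
  moreover have "?Q * ?P = four_block_mat (1\<^sub>m n) A (0\<^sub>m m n) (1\<^sub>m m + B * A)"
    using A B
    by (subst mult_four_block_mat[where ?n1.0 = n and ?n2.0 = m])
       (auto simp: comm_add_mat[where nr = m and nc = m])
  then have "det (?Q * ?P) = det (1\<^sub>m m + B * A)"
    using A B by (simp add: det_four_block_mat_lower_left_zero[where n = n and m = m])
  ultimately show ?thesis
    using det_mult[OF P Q] det_mult[OF Q P] by (simp add: mult.commute)
qed

lemma det_rank_one_update:
  fixes u v :: "nat \<Rightarrow> 'a::field"
  shows "det (mat k k (\<lambda>(i, j). (if i = j then 1 else 0) + u i * v j)) = 1 + (\<Sum>i<k. v i * u i)"
proof -
  let ?U = "mat k 1 (\<lambda>(i, j). u i)" and ?V = "mat 1 k (\<lambda>(i, j). v j)"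
  have "mat k k (\<lambda>(i, j). (if i = j then 1 else 0) + u i * v j) = 1\<^sub>m k + ?U * ?V"
    by (rule eq_matI) (auto simp: scalar_prod_def)
  moreover have "det (1\<^sub>m 1 + ?V * ?U) = 1 + (\<Sum>i<k. v i * u i)"
    by (subst det_single) (auto simp: scalar_prod_def atLeast0LessThan)
  ultimately show ?thesis
    using sylvester_det[of ?U k 1 ?V] by simp
qed

text \<open>Doubling the matrix gives a rank-one update of the identity, of determinant
  \<open>k + 1\<close>.\<close>

lemma det_simplex_gram:
  "det (mat k k (\<lambda>(i, j). if i = j then 1 else 1 / 2 :: 'a::field_char_0)) = of_nat (Suc k) / 2 ^ k"
proof -
  have "mat k k (\<lambda>(i, j). if i = j then 1 else 1 / 2 :: 'a) =
      (1 / 2) \<cdot>\<^sub>m mat k k (\<lambda>(i, j). (if i = j then 1 else 0) + 1 * 1)"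
    by (rule eq_matI) auto
  then show ?thesis
    using det_rank_one_update[of k "\<lambda>_. 1 :: 'a" "\<lambda>_. 1"] by (simp add: power_one_over)
qed

lemma det_border:
  fixes f :: "nat \<times> nat \<Rightarrow> 'a::field"
  assumes "\<And>i. i < k \<Longrightarrow> f (i, k) = 0"
  shows "det (mat (Suc k) (Suc k) f) = det (mat k k f) * f (k, k)"
proof -
  have "mat (Suc k) (Suc k) f =
      four_block_mat (mat k k f) (0\<^sub>m k 1) (mat 1 k (\<lambda>(i, j). f (k, j))) (mat 1 1 (\<lambda>_. f (k, k)))"
    by (rule eq_matI) (auto simp: assms less_Suc_eq)
  then show ?thesis
    by (simp add: det_four_block_mat_upper_right_zero_col[where n = k] det_single)
qed

section \<open>The standard bilinear form\<close>

definition dot :: "nat \<Rightarrow> (nat \<Rightarrow> 'a) \<Rightarrow> (nat \<Rightarrow> 'a) \<Rightarrow> 'a::field" where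
  "dot n u v = (\<Sum>l<n. u l * v l)"

lemma dot_commute: "dot n u v = dot n v u"
  by (simp add: dot_def mult.commute)

lemma dot_add_left: "dot n (\<lambda>l. u l + v l) w = dot n u w + dot n v w"
  by (simp add: dot_def sum.distrib algebra_simps)

lemma dot_diff_left: "dot n (\<lambda>l. u l - v l) w = dot n u w - dot n v w"
  by (simp add: dot_def sum_subtractf algebra_simps)

lemma dot_scale_left: "dot n (\<lambda>l. c * u l) w = c * dot n u w"
  by (simp add: dot_def sum_distrib_left algebra_simps)

lemma dot_add_right: "dot n w (\<lambda>l. u l + v l) = dot n w u + dot n w v"
  by (simp add: dot_def sum.distrib algebra_simps)

lemma dot_diff_right: "dot n w (\<lambda>l. u l - v l) = dot n w u - dot n w v"
  by (simp add: dot_def sum_subtractf algebra_simps)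

lemma dot_scale_right: "dot n w (\<lambda>l. c * u l) = c * dot n w u"
  by (simp add: dot_def sum_distrib_left algebra_simps)

lemma dot_sum_left: "dot n (\<lambda>l. \<Sum>i<k. f i l) w = (\<Sum>i<k. dot n (f i) w)"
  by (simp add: dot_def sum_distrib_right sum.swap[of _ "{..<k}" "{..<n}"])

lemma dot_sum_right: "dot n w (\<lambda>l. \<Sum>i<k. f i l) = (\<Sum>i<k. dot n w (f i))"
  by (simp add: dot_commute[of n w] dot_sum_left)

lemma det_power2_eq_gram:
  "(det (mat n n (\<lambda>(i, l). y i l)))\<^sup>2 = det (mat n n (\<lambda>(i, j). dot n (y i) (y j)))"
proof -
  let ?M = "mat n n (\<lambda>(i, l). y i l)"
  have "mat n n (\<lambda>(i, j). dot n (y i) (y j)) = ?M * transpose_mat ?M"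
    by (rule eq_matI) (auto simp: dot_def scalar_prod_def atLeast0LessThan)
  then have "det (mat n n (\<lambda>(i, j). dot n (y i) (y j))) = det ?M * det (transpose_mat ?M)"
    by (simp add: det_mult[where n = n])
  then show ?thesis
    by (simp add: det_transpose[where n = n] power2_eq_square)
qed

section \<open>Equidistant points\<close>

text \<open>Only coordinates below \<open>n\<close> matter. As 1 is nonzero, distinct indices give
  distinct points, so such a family describes a clique of size \<open>m\<close>.\<close>

definition equidistant :: "nat \<Rightarrow> nat \<Rightarrow> (nat \<Rightarrow> nat \<Rightarrow> 'a::field) \<Rightarrow> bool" where
  "equidistant m n x \<longleftrightarrow>
     (\<forall>i<m. \<forall>j<m. i \<noteq> j \<longrightarrow> dot n (\<lambda>l. x i l - x j l) (\<lambda>l. x i l - x j l) = 1)"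

text \<open>Polarisation: the unit edge between points \<open>i\<close> and \<open>j\<close> gives 1
  = 1 + 1 - 2 \<open>dot n (y i) (y j)\<close>.\<close>

lemma equidistant_gram:
  fixes x :: "nat \<Rightarrow> nat \<Rightarrow> 'a::field_char_0"
  assumes "equidistant (Suc m) n x" "i < m" "j < m"
  shows "dot n (\<lambda>l. x i l - x m l) (\<lambda>l. x j l - x m l) = (if i = j then 1 else 1 / 2)"
proof -
  let ?y = "\<lambda>i l. x i l - x m l"
  have diag: "dot n (?y i) (?y i) = 1" if "i < m" for i
    using assms(1) that by (auto simp: equidistant_def)
  show ?thesis
  proof (cases "i = j")
    case False
    have "dot n (\<lambda>l. ?y i l - ?y j l) (\<lambda>l. ?y i l - ?y j l) = 1"
      using assms False by (simp add: equidistant_def)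
    then have "2 * dot n (?y i) (?y j) = 1"
      using diag[of i] diag[of j] assms(2,3)
      unfolding dot_diff_left[of n "?y i" "?y j"] dot_diff_right[of n _ "?y i" "?y j"]
      by (simp add: dot_commute[of n "?y j" "?y i"])
    then show ?thesis
      using False by (simp add: field_simps)
  qed (use diag assms in simp)
qed

text \<open>Padding by a zero coordinate turns the \<open>n + 1\<close> edge vectors into a square
  matrix with a zero column, while their Gram determinant is nonzero in characteristic 0.\<close>

lemma equidistant_le:
  fixes x :: "nat \<Rightarrow> nat \<Rightarrow> 'a::field_char_0"
  shows "\<not> equidistant (Suc (Suc n)) n x"
proof
  assume eq: "equidistant (Suc (Suc n)) n x"
  define y where "y = (\<lambda>i l. if l < n then x i l - x (Suc n) l else 0)"
  have "dot (Suc n) (y i) (y j) = (if i = j then 1 else 1 / 2)" if "i < Suc n" "j < Suc n" for i j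
    using equidistant_gram[OF eq that] by (simp add: dot_def y_def)
  then have "mat (Suc n) (Suc n) (\<lambda>(i, j). dot (Suc n) (y i) (y j)) =
      mat (Suc n) (Suc n) (\<lambda>(i, j). if i = j then 1 else 1 / 2)"
    by (intro eq_matI) auto
  then have "(det (mat (Suc n) (Suc n) (\<lambda>(i, l). y i l)))\<^sup>2 = of_nat (Suc (Suc n)) / 2 ^ Suc n"
    by (simp only: det_power2_eq_gram det_simplex_gram)
  moreover have "det (mat (Suc n) (Suc n) (\<lambda>(i, l). y i l)) = 0"
    by (subst det_border) (auto simp: y_def)
  ultimately have "of_nat (Suc (Suc n)) / 2 ^ Suc n = (0 :: 'a)"
    by (metis zero_power2)
  then show False
    by (simp del: of_nat_Suc)
qed

lemma equidistant_Suc_dim_square: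
  fixes x :: "nat \<Rightarrow> nat \<Rightarrow> 'a::field_char_0"
  assumes eq: "equidistant (Suc n) n x" and "odd n"
  shows "(2 * (of_nat n + 1) :: 'a) \<in> nonzero_squares"
proof -
  define y where "y = (\<lambda>i l. x i l - x n l)"
  let ?d = "det (mat n n (\<lambda>(i, l). y i l))"
  have "mat n n (\<lambda>(i, j). dot n (y i) (y j)) = mat n n (\<lambda>(i, j). if i = j then 1 else 1 / 2)"
    using equidistant_gram[OF eq] by (intro eq_matI) (auto simp: y_def)
  then have d: "?d\<^sup>2 = of_nat (Suc n) / 2 ^ n"
    by (simp only: det_power2_eq_gram det_simplex_gram)
  obtain h where n: "n = 2 * h + 1"
    using \<open>odd n\<close> by (elim oddE)
  \<comment> \<open>For odd \<open>n\<close>, \<open>2 * 2 ^ n\<close> is a square; this clears the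
    denominator of the squared determinant and leaves \<open>2 * (n + 1)\<close>.\<close>
  have pow: "(2 ^ Suc h)\<^sup>2 = (2 * 2 ^ n :: 'a)"
    by (simp add: n power_mult[symmetric] power_mult_distrib mult.commute)
  have "(?d * 2 ^ Suc h)\<^sup>2 = 2 * (of_nat n + 1)"
    by (simp only: power_mult_distrib d pow) simp
  moreover have "?d \<noteq> 0"
    using d by (metis divide_eq_0_iff of_nat_Suc of_nat_neq_0 power_not_zero zero_neq_numeral zero_power2)
  ultimately show ?thesis
    unfolding nonzero_squares_def
    by (metis (mono_tags, lifting) mem_Collect_eq mult_eq_0_iff power_not_zero zero_neq_numeral)
qed

text \<open>Orthogonality forces every \<open>c j\<close> to be \<open>- S\<close>, and summing
  gives \<open>(k + 1) * S = 0\<close>. As the form may be isotropic, this says more than linear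
  independence: the span of the edges meets its orthogonal complement only in 0.\<close>

lemma equidistant_independent:
  fixes x :: "nat \<Rightarrow> nat \<Rightarrow> 'a::field_char_0"
  assumes eq: "equidistant (Suc k) n x"
    and orth: "\<And>j. j < k \<Longrightarrow> dot n (\<lambda>l. \<Sum>i<k. c i * (x i l - x k l)) (\<lambda>l. x j l - x k l) = 0"
    and j: "j < k"
  shows "c j = 0"
proof -
  define S where "S = (\<Sum>i<k. c i)"
  have c: "c j = - S" if "j < k" for j
  proof -
    have "0 = (\<Sum>i<k. c i * (if i = j then 1 else 1 / 2))"
      using orth[OF that] equidistant_gram[OF eq _ that] by (simp add: dot_sum_left dot_scale_left)
    also have "\<dots> = (\<Sum>i<k. c i / 2 + (if i = j then c i / 2 else 0))"
      by (intro sum.cong) auto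
    also have "\<dots> = S / 2 + c j / 2"
      using that by (simp add: sum.distrib S_def sum_divide_distrib)
    finally have "S + c j = 0"
      by (simp add: field_simps)
    then show ?thesis
      by (simp add: add_eq_0_iff)
  qed
  have "S = (\<Sum>i<k. - S)"
    using c by (subst S_def) simp
  then have "S + of_nat k * S = 0"
    by (simp only: sum_constant card_lessThan mult_minus_right eq_neg_iff_add_eq_0)
  then have "of_nat (Suc k) * S = 0"
    by (simp add: algebra_simps)
  then show ?thesis
    using c[OF j] by (simp del: of_nat_Suc)
qed

text \<open>The Gram determinant of the \<open>k\<close> edges and a normal \<open>w\<close> is a
  square and equals \<open>(k + 1) / 2 ^ k\<close> times the length of \<open>w\<close>; for even
  \<open>k\<close> the denominator is a square too.\<close>

lemma equidistant_normal:
  fixes x :: "nat \<Rightarrow> nat \<Rightarrow> 'a::field_char_0"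
  assumes eq: "equidistant (Suc k) (Suc k) x" and "even k"
  obtains w s where "s \<noteq> 0" "dot (Suc k) w w * of_nat (Suc k) = s\<^sup>2"
    "\<And>i. i < k \<Longrightarrow> dot (Suc k) (\<lambda>l. x i l - x k l) w = 0"
proof -
  let ?n = "Suc k"
  define y where "y = (\<lambda>i l. x i l - x k l)"
  have gram: "dot ?n (y i) (y j) = (if i = j then 1 else 1 / 2)" if "i < k" "j < k" for i j
    using equidistant_gram[OF eq that] by (simp add: y_def)
  \<comment> \<open>Used first with \<open>w = 0\<close>, to obtain a nonzero \<open>w\<close> orthogonal to all \<open>y i\<close>, and then
    with that \<open>w\<close>.\<close>
  have det: "(det (mat ?n ?n (\<lambda>(i, l). if i < k then y i l else w l)))\<^sup>2 =
      of_nat ?n / 2 ^ k * dot ?n w w"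
    if orth: "\<And>i. i < k \<Longrightarrow> dot ?n (y i) w = 0" for w
  proof -
    define z where "z = (\<lambda>i l. if i < k then y i l else w l)"
    have z: "z i = (if i < k then y i else w)" for i
      by (auto simp: z_def)
    have "(det (mat ?n ?n (\<lambda>(i, l). z i l)))\<^sup>2 = det (mat ?n ?n (\<lambda>(i, j). dot ?n (z i) (z j)))"
      by (rule det_power2_eq_gram)
    also have "\<dots> = det (mat k k (\<lambda>(i, j). dot ?n (z i) (z j))) * dot ?n w w"
      by (subst det_border) (auto simp: z orth)
    also have "mat k k (\<lambda>(i, j). dot ?n (z i) (z j)) = mat k k (\<lambda>(i, j). if i = j then 1 else 1 / 2)"
      by (rule eq_matI) (auto simp: z gram)
    finally show ?thesis
      by (simp add: det_simplex_gram z_def del: of_nat_Suc)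
  qed
  have "det (mat ?n ?n (\<lambda>(i, l). if i < k then y i l else 0)) = 0"
    using det[of "\<lambda>_. 0"] by (simp add: dot_def)
  then obtain v where v: "v \<in> carrier_vec ?n" "v \<noteq> 0\<^sub>v ?n"
    "mat ?n ?n (\<lambda>(i, l). if i < k then y i l else 0) *\<^sub>v v = 0\<^sub>v ?n"
    using det_0_iff_vec_prod_zero[of "mat ?n ?n (\<lambda>(i, l). if i < k then y i l else 0)" ?n] by auto
  define w where "w = (\<lambda>l. v $ l)"
  have orth: "dot ?n (y i) w = 0" if "i < k" for i
    using arg_cong[OF v(3), of "\<lambda>u. u $ i"] that v(1)
    by (auto simp: scalar_prod_def dot_def w_def atLeast0LessThan)
  let ?M = "mat ?n ?n (\<lambda>(i, l). if i < k then y i l else w l)"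
  \<comment> \<open>A priori \<open>w\<close> may be isotropic, so a relation among the rows cannot
    be paired with \<open>w\<close>. Pairing it with the edges kills their coefficients, and then
    \<open>w\<close> being nonzero kills the last one.\<close>
  have "det ?M \<noteq> 0"
  proof
    assume "det ?M = 0"
    then have "det (transpose_mat ?M) = 0"
      by (simp add: det_transpose[where n = ?n])
    then obtain c where c: "c \<in> carrier_vec ?n" "c \<noteq> 0\<^sub>v ?n" "transpose_mat ?M *\<^sub>v c = 0\<^sub>v ?n"
      using det_0_iff_vec_prod_zero[of "transpose_mat ?M" ?n] by auto
    have lin: "(\<Sum>i<k. c $ i * y i l) + c $ k * w l = 0" if "l < ?n" for l
    proof -
      have "(transpose_mat ?M *\<^sub>v c) $ l = (\<Sum>i<?n. (if i < k then y i l else w l) * c $ i)"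
        using that c(1) by (auto simp: scalar_prod_def atLeast0LessThan intro!: sum.cong)
      then show ?thesis
        using that by (simp add: c(3) mult.commute)
    qed
    have "dot ?n (\<lambda>l. \<Sum>i<k. c $ i * y i l) (y j) = 0" if "j < k" for j
    proof -
      have "dot ?n (\<lambda>l. (\<Sum>i<k. c $ i * y i l) + c $ k * w l) (y j) = 0"
        unfolding dot_def using lin by (intro sum.neutral) simp
      then show ?thesis
        using orth[OF that] by (simp add: dot_add_left dot_scale_left dot_commute[of _ w "y j"])
    qed
    then have c0: "c $ i = 0" if "i < k" for i
      using equidistant_independent[OF eq _ that, of "\<lambda>i. c $ i"] by (simp add: y_def)
    have "c $ k \<noteq> 0"
      using c(1,2) c0 by (auto simp: vec_eq_iff less_Suc_eq)
    then have "w l = 0" if "l < ?n" for l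
      using lin[OF that] c0 by simp
    then show False
      using v(1,2) by (auto simp: w_def vec_eq_iff)
  qed
  moreover obtain h where k: "k = 2 * h"
    using \<open>even k\<close> by (elim evenE)
  have pow: "(2 ^ h)\<^sup>2 = (2 ^ k :: 'a)"
    by (simp add: k power_mult[symmetric] mult.commute)
  have "(det ?M)\<^sup>2 = of_nat ?n / 2 ^ k * dot ?n w w"
    by (rule det) (rule orth)
  then have "dot ?n w w * of_nat ?n = (det ?M * 2 ^ h)\<^sup>2"
    by (simp add: power_mult_distrib pow mult.commute del: of_nat_Suc)
  ultimately show thesis
    using orth by (intro that[of "det ?M * 2 ^ h" w]) (auto simp: y_def)
qed

section \<open>The forced representation\<close>

text \<open>This replaces Witt cancellation, as in the proof of the Bruck--Ryser theorem: the sign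
  in \<open>L j = \<plusminus> m j\<close> is chosen so that this equation can be solved for \<open>m j\<close>.\<close>

lemma exists_matching_squares:
  fixes A :: "nat \<Rightarrow> nat \<Rightarrow> 'a::field_char_0"
  shows "\<exists>m. \<forall>j<k. ((\<Sum>i<k. m i * A i j) + b j)\<^sup>2 = (m j)\<^sup>2"
proof (induction k arbitrary: A b)
  case (Suc k)
  obtain e :: 'a where e: "e\<^sup>2 = 1" "e \<noteq> A k k"
  proof (cases "A k k = 1")
    case True
    then have "- 1 \<noteq> A k k" by simp
    then show ?thesis using that[of "- 1"] by simp
  qed (use that[of 1] in auto)
  define D where "D = e - A k k"
  have D: "D \<noteq> 0"
    using e by (simp add: D_def)
  \<comment> \<open>These coefficients arise by substituting the last unknown \<open>t\<close>,
    which solves \<open>L k = e * t\<close>, into the other forms.\<close>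
  obtain m where m: "\<And>j. j < k \<Longrightarrow>
      ((\<Sum>i<k. m i * (A i j + A i k / D * A k j)) + (b j + b k / D * A k j))\<^sup>2 = (m j)\<^sup>2"
    using Suc[of "\<lambda>i j. A i j + A i k / D * A k j" "\<lambda>j. b j + b k / D * A k j"] by auto
  define t where "t = ((\<Sum>i<k. m i * A i k) + b k) / D"
  have "((\<Sum>i<k. m i * A i j) + t * A k j + b j)\<^sup>2 = (m j)\<^sup>2" if "j < k" for j
  proof -
    have "(\<Sum>i<k. m i * A i j) + t * A k j + b j =
        (\<Sum>i<k. m i * (A i j + A i k / D * A k j)) + (b j + b k / D * A k j)"
      by (simp add: t_def algebra_simps sum.distrib sum_distrib_left sum_divide_distrib add_divide_distrib)
    then show ?thesis
      by (simp only: m[OF that])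
  qed
  moreover have "(\<Sum>i<k. m i * A i k) + t * A k k + b k = e * t"
  proof -
    have "(\<Sum>i<k. m i * A i k) + b k = D * t"
      using D by (simp add: t_def)
    then show ?thesis
      by (simp add: D_def algebra_simps)
  qed
  ultimately show ?case
    using e(1) by (intro exI[of _ "m(k := t)"]) (auto simp: less_Suc_eq power_mult_distrib)
qed simp

text \<open>An explicit similarity of \<open>2h \<times> \<langle>1\<rangle>\<close> with factor 2.\<close>

definition butterfly :: "(nat \<Rightarrow> 'a) \<Rightarrow> nat \<Rightarrow> 'a::field" where
  "butterfly f i = (if even i then f i + f (Suc i) else f (i - 1) - f i)"

lemma dot_butterfly: "dot (2 * h) (butterfly f) (butterfly g) = 2 * dot (2 * h) f g"
  by (induction h) (auto simp: dot_def butterfly_def algebra_simps)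

text \<open>Each of the 2-by-2 blocks is a symmetric matrix.\<close>

lemma dot_butterfly_left: "dot (2 * h) (butterfly f) g = dot (2 * h) f (butterfly g)"
  by (induction h) (auto simp: dot_def butterfly_def algebra_simps)

lemma butterfly_diff: "butterfly (\<lambda>l. f l - g l) i = butterfly f i - butterfly g i"
  by (simp add: butterfly_def)

text \<open>Combining the edges with coefficients \<open>butterfly m\<close> gives a vector
  \<open>u\<close> orthogonal to \<open>w\<close>, of length \<open>dot k m m\<close> plus half a
  square. If the first \<open>k\<close> coordinates of \<open>u + w\<close> are those of
  \<open>m\<close> up to sign, \<open>dot k m m\<close> cancels from the length of
  \<open>u + w\<close>, leaving the length of \<open>w\<close> as a square minus twice a
  square.\<close>

lemma equidistant_full_norm_form:
  fixes x :: "nat \<Rightarrow> nat \<Rightarrow> 'a::field_char_0"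
  assumes eq: "equidistant n n x" and "odd n"
  shows "\<exists>a b :: 'a. of_nat n = a\<^sup>2 - 2 * b\<^sup>2"
proof -
  obtain h where h: "n = Suc (2 * h)"
    using \<open>odd n\<close> by (metis oddE Suc_eq_plus1)
  define k where "k = 2 * h"
  have n: "n = Suc k" and k: "even k" using h by (simp_all add: k_def)
  obtain w s where s: "s \<noteq> 0" "dot n w w * of_nat n = s\<^sup>2"
    and orth: "\<And>i. i < k \<Longrightarrow> dot n (\<lambda>l. x i l - x k l) w = 0"
    using equidistant_normal[of k x] eq k unfolding n by blast
  define y where "y = (\<lambda>i l. x i l - x k l)"
  \<comment> \<open>Since \<open>butterfly\<close> is self-adjoint, the expression squared here is
    coordinate \<open>j\<close> of \<open>u + w\<close>, with \<open>u\<close> as below.\<close>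
  obtain m where m: "\<And>j. j < k \<Longrightarrow>
      ((\<Sum>i<k. m i * butterfly (\<lambda>i. y i j) i) + w j)\<^sup>2 = (m j)\<^sup>2"
    using exists_matching_squares[of k "\<lambda>i j. butterfly (\<lambda>i. y i j) i" w] by auto
  define z where "z = butterfly m"
  define u where "u = (\<lambda>l. \<Sum>i<k. z i * y i l)"
  have u: "(\<Sum>i<k. m i * butterfly (\<lambda>i. y i l) i) = u l" for l
    using dot_butterfly_left[of h m "\<lambda>i. y i l"] by (simp add: u_def z_def dot_def k_def)
  define S where "S = (\<Sum>i<k. z i)"
  have uw: "dot n u w = 0"
    using orth by (simp add: u_def dot_sum_left dot_scale_left y_def)
  have uu: "dot n u u = dot k z z / 2 + S\<^sup>2 / 2"
  proof -
    have "dot n u u = (\<Sum>i<k. \<Sum>j<k. z i * z j * dot n (y i) (y j))"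
      by (simp add: u_def dot_sum_left dot_sum_right dot_scale_left dot_scale_right
          sum_distrib_left algebra_simps)
    also have "\<dots> = (\<Sum>i<k. \<Sum>j<k. z i * z j / 2 + (if j = i then z i * z j / 2 else 0))"
      using equidistant_gram[of k n x] eq n by (intro sum.cong) (auto simp: y_def)
    also have "\<dots> = (\<Sum>i<k. \<Sum>j<k. z i * z j) / 2 + dot k z z / 2"
      by (simp add: sum.distrib dot_def sum_divide_distrib)
    also have "(\<Sum>i<k. \<Sum>j<k. z i * z j) = S\<^sup>2"
      by (simp add: S_def power2_eq_square sum_product)
    finally show ?thesis by simp
  qed
  have "dot k m m + (u k + w k)\<^sup>2 = dot n (\<lambda>l. u l + w l) (\<lambda>l. u l + w l)"
    using m by (simp add: dot_def n u power2_eq_square)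
  also have "\<dots> = dot n u u + dot n w w"
    using uw by (simp add: dot_add_left dot_add_right dot_commute[of n w u])
  also have "dot n u u = dot k m m + 2 * (S / 2)\<^sup>2"
    using dot_butterfly[of h m m] by (simp add: uu z_def k_def power2_eq_square)
  finally have q: "dot n w w = (u k + w k)\<^sup>2 - 2 * (S / 2)\<^sup>2"
    by (simp add: algebra_simps)
  let ?q = "dot n w w"
  have q0: "?q \<noteq> 0"
    using s by auto
  \<comment> \<open>From \<open>?q * n = s^2\<close> follows
    \<open>n = ?q * (s / ?q)^2\<close>.\<close>
  define t where "t = s / ?q"
  have "of_nat n = ?q * t\<^sup>2"
    using s(2) q0 by (simp add: t_def field_simps power2_eq_square)
  also have "\<dots> = ((u k + w k) * t)\<^sup>2 - 2 * (S / 2 * t)\<^sup>2"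
    unfolding q power_mult_distrib by (simp only: left_diff_distrib mult.assoc)
  finally show ?thesis by blast
qed

section \<open>Two forms of the arithmetic condition\<close>

lemma represented_iff:
  "(of_nat n :: 'a::field_char_0) \<in> represented [1, 2 * (of_nat n - 1)] \<longleftrightarrow>
     n > 0 \<and> (\<exists>a b :: 'a. of_nat n = a\<^sup>2 + 2 * (of_nat n - 1) * b\<^sup>2)"
proof -
  let ?c = "[1, 2 * (of_nat n - 1)] :: 'a list"
  have form: "diag_form ?c v = (v $ 0)\<^sup>2 + 2 * (of_nat n - 1) * (v $ 1)\<^sup>2" for v
    by (simp add: diag_form_def numeral_2_eq_2)
  have "(\<exists>v\<in>carrier_vec 2. of_nat n = diag_form ?c v) \<longleftrightarrow>
      (\<exists>a b :: 'a. of_nat n = a\<^sup>2 + 2 * (of_nat n - 1) * b\<^sup>2)"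
  proof
    assume "\<exists>a b :: 'a. of_nat n = a\<^sup>2 + 2 * (of_nat n - 1) * b\<^sup>2"
    then obtain a b :: 'a where "of_nat n = a\<^sup>2 + 2 * (of_nat n - 1) * b\<^sup>2" by blast
    then show "\<exists>v\<in>carrier_vec 2. of_nat n = diag_form ?c v"
      unfolding form by (intro bexI[of _ "vec 2 (\<lambda>i. if i = 0 then a else b)"]) auto
  next
    assume "\<exists>v\<in>carrier_vec 2. of_nat n = diag_form ?c v"
    then show "\<exists>a b :: 'a. of_nat n = a\<^sup>2 + 2 * (of_nat n - 1) * b\<^sup>2"
      unfolding form by blast
  qed
  then show ?thesis
    by (auto simp: represented_def image_iff numeral_2_eq_2)
qed

text \<open>Since \<open>n\<close> is a norm from \<open>F(\<surd>(1 - n))\<close>, being a norm from \<open>F(\<surd>2)\<close> is the same as being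
  one from \<open>F(\<surd>(2(1 - n)))\<close>. Explicitly,
  \<open>(a + n)\<^sup>2 + 2(n - 1)b\<^sup>2 = n(a + 1)\<^sup>2\<close> whenever \<open>n = a\<^sup>2 - 2b\<^sup>2\<close>.\<close>

lemma represented_of_norm_form:
  fixes a b :: "'a::field_char_0"
  assumes ab: "of_nat n = a\<^sup>2 - 2 * b\<^sup>2" and "n > 0"
  shows "(of_nat n :: 'a) \<in> represented [1, 2 * (of_nat n - 1)]"
proof -
  \<comment> \<open>The identity is divided by the square of \<open>a + 1\<close>; if
    \<open>a = -1\<close>, changing the sign of \<open>a\<close> makes this 2.\<close>
  obtain c where c: "of_nat n = c\<^sup>2 - 2 * b\<^sup>2" "c + 1 \<noteq> 0"
  proof (cases "a + 1 = 0")
    case True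
    then have "- a + 1 \<noteq> 0" by (simp add: eq_neg_iff_add_eq_0[symmetric])
    then show ?thesis using that[of "- a"] ab by simp
  qed (use that[of a] ab in auto)
  have "(c + of_nat n)\<^sup>2 + 2 * (of_nat n - 1) * b\<^sup>2 = of_nat n * (c + 1)\<^sup>2"
    unfolding c(1) by (simp add: power2_eq_square algebra_simps)
  then have "of_nat n = ((c + of_nat n) / (c + 1))\<^sup>2 + 2 * (of_nat n - 1) * (b / (c + 1))\<^sup>2"
    using c(2) by (simp add: power_divide add_divide_distrib[symmetric] eq_divide_eq)
  then show ?thesis
    using represented_iff \<open>n > 0\<close> by blast
qed

section \<open>Constructions\<close>

lemma equidistant_SucI:
  assumes "equidistant m n x"
    and "\<And>i. i < m \<Longrightarrow> dot n (\<lambda>l. p l - x i l) (\<lambda>l. p l - x i l) = 1"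
  shows "equidistant (Suc m) n (x(m := p))"
proof -
  have "dot n (\<lambda>l. x i l - p l) (\<lambda>l. x i l - p l) = 1" if "i < m" for i
    using assms(2)[OF that] by (simp add: dot_def algebra_simps)
  then show ?thesis
    using assms by (auto simp: equidistant_def less_Suc_eq)
qed

text \<open>Half the \<open>butterfly\<close> image of a unit vector: the squared distance 2 is
  multiplied by 2/4. The coordinates from \<open>k\<close> on stay free for a further point.\<close>

definition standard_points :: "nat \<Rightarrow> nat \<Rightarrow> nat \<Rightarrow> 'a::field" where
  "standard_points k i l = (if l < k then butterfly (\<lambda>l. if l = i then 1 else 0) l / 2 else 0)"

lemma equidistant_standard_points:
  "equidistant (2 * h) (Suc (2 * h)) (standard_points (2 * h) :: nat \<Rightarrow> nat \<Rightarrow> 'a::field_char_0)"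
  unfolding equidistant_def
proof (intro allI impI)
  fix i j :: nat
  assume ij: "i < 2 * h" "j < 2 * h" "i \<noteq> j"
  let ?x = "standard_points (2 * h) :: nat \<Rightarrow> nat \<Rightarrow> 'a"
  define f where "f = (\<lambda>l. (if l = i then 1 else 0) - (if l = j then 1 else 0) :: 'a)"
  have "dot (Suc (2 * h)) (\<lambda>l. ?x i l - ?x j l) (\<lambda>l. ?x i l - ?x j l) =
      dot (2 * h) (\<lambda>l. 1 / 2 * butterfly f l) (\<lambda>l. 1 / 2 * butterfly f l)"
    by (simp add: dot_def standard_points_def f_def butterfly_diff diff_divide_distrib)
  also have "\<dots> = dot (2 * h) f f / 2"
    by (simp only: dot_scale_left dot_scale_right dot_butterfly) simp
  also have "dot (2 * h) f f = (\<Sum>l<2 * h. (if l = i then 1 else 0) + (if l = j then 1 else 0))"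
    unfolding dot_def using ij(3) by (intro sum.cong) (auto simp: f_def)
  also have "\<dots> = 2"
    using ij by (simp add: sum.distrib)
  finally show "dot (Suc (2 * h)) (\<lambda>l. ?x i l - ?x j l) (\<lambda>l. ?x i l - ?x j l) = 1"
    by simp
qed

lemma exists_equidistant_full:
  fixes a b :: "'a::field_char_0"
  assumes "odd n" and ab: "of_nat n = a\<^sup>2 + 2 * (of_nat n - 1) * b\<^sup>2"
  shows "\<exists>x :: nat \<Rightarrow> nat \<Rightarrow> 'a. equidistant n n x"
proof (cases "n = 1")
  case True
  then show ?thesis by (simp add: equidistant_def)
next
  case False
  obtain h where n: "n = Suc (2 * h)"
    using \<open>odd n\<close> by (metis oddE Suc_eq_plus1)
  have K: "of_nat (2 * h) \<noteq> (0 :: 'a)"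
    using False n by (simp only: of_nat_eq_0_iff)
  define K where "K = (of_nat (2 * h) :: 'a)"
  \<comment> \<open>Multiplied by \<open>2 * K\<close>, where \<open>K = n - 1\<close> is nonzero,
    the distance condition becomes \<open>(K * c - 1)^2 + 2 * K * b^2 = n\<close>, so
    \<open>K * c - 1 = a\<close> solves it.\<close>
  define c where "c = (a + 1) / K"
  \<comment> \<open>A multiple of the sum of the standard points, lifted to height \<open>b\<close>
    in the last coordinate.\<close>
  define p where "p = (\<lambda>l. if l < 2 * h then butterfly (\<lambda>_. c) l / 2 else b)"
  let ?x = "standard_points (2 * h) :: nat \<Rightarrow> nat \<Rightarrow> 'a"
  have "dot n (\<lambda>l. p l - ?x i l) (\<lambda>l. p l - ?x i l) = 1" if i: "i < 2 * h" for i
  proof -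
    define f where "f = (\<lambda>l. c - (if l = i then 1 else 0))"
    have "dot n (\<lambda>l. p l - ?x i l) (\<lambda>l. p l - ?x i l) =
        dot (2 * h) (\<lambda>l. 1 / 2 * butterfly f l) (\<lambda>l. 1 / 2 * butterfly f l) + b\<^sup>2"
      by (simp add: dot_def n standard_points_def p_def f_def butterfly_diff diff_divide_distrib
          power2_eq_square)
    also have "\<dots> = dot (2 * h) f f / 2 + b\<^sup>2"
      by (simp only: dot_scale_left dot_scale_right dot_butterfly) simp
    also have "dot (2 * h) f f = (\<Sum>l<2 * h. c\<^sup>2 + (if l = i then 1 - 2 * c else 0))"
      unfolding dot_def by (intro sum.cong) (auto simp: f_def power2_eq_square algebra_simps)
    also have "\<dots> = K * c\<^sup>2 + 1 - 2 * c"
      using i by (simp add: sum.distrib K_def)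
    also have "(K * c\<^sup>2 + 1 - 2 * c) / 2 + b\<^sup>2 = 1"
    proof -
      have norm: "K + 1 = a\<^sup>2 + 2 * K * b\<^sup>2"
        using ab by (simp add: n K_def algebra_simps)
      have Kc: "K * c = a + 1"
        using K by (simp add: c_def K_def)
      have "K * (K * c\<^sup>2 + 1 - 2 * c + 2 * b\<^sup>2) =
          (K * c)\<^sup>2 - 2 * (K * c) + K + 2 * K * b\<^sup>2"
        by (simp add: power2_eq_square algebra_simps)
      also have "\<dots> = (a\<^sup>2 + 2 * K * b\<^sup>2) + K - 1"
        unfolding Kc by (simp add: power2_eq_square algebra_simps)
      also have "\<dots> = K * 2"
        unfolding norm[symmetric] by simp
      finally have "K * (K * c\<^sup>2 + 1 - 2 * c + 2 * b\<^sup>2) = K * 2" .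
      then have "K * c\<^sup>2 + 1 - 2 * c + 2 * b\<^sup>2 = 2"
        using K unfolding K_def by (metis mult_left_cancel)
      then show ?thesis
        by (simp add: field_simps)
    qed
    finally show ?thesis .
  qed
  then have "equidistant (Suc (2 * h)) n (?x(2 * h := p))"
    using equidistant_standard_points[of h] by (intro equidistant_SucI) (auto simp: n)
  then show ?thesis
    using n by blast
qed

lemma exists_equidistant_Suc:
  fixes x :: "nat \<Rightarrow> nat \<Rightarrow> 'a::field_char_0"
  assumes eq: "equidistant n n x" and "odd n"
    and sq: "(2 * (of_nat n + 1) :: 'a) \<in> nonzero_squares"
  shows "\<exists>x :: nat \<Rightarrow> nat \<Rightarrow> 'a. equidistant (Suc n) n x"
proof -
  obtain h where h: "n = Suc (2 * h)"
    using \<open>odd n\<close> by (metis oddE Suc_eq_plus1)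
  define k where "k = 2 * h"
  have n: "n = Suc k" and k: "even k" using h by (simp_all add: k_def)
  obtain w s where s: "s \<noteq> 0" "dot n w w * of_nat n = s\<^sup>2"
    and orth: "\<And>i. i < k \<Longrightarrow> dot n (\<lambda>l. x i l - x k l) w = 0"
    using equidistant_normal[of k x] eq k unfolding n by blast
  obtain \<beta> :: 'a where \<beta>: "2 * (of_nat n + 1) = \<beta>\<^sup>2"
    using sq by (auto simp: nonzero_squares_def)
  define N where "N = (of_nat n :: 'a)"
  have N: "N \<noteq> 0" "of_nat k = N - 1"
    using n by (auto simp: N_def simp del: of_nat_Suc) simp
  define y where "y = (\<lambda>i l. x i l - x k l)"
  \<comment> \<open>Makes the length of \<open>r * w\<close> equal to
    \<open>(N + 1) / (2 * N)\<close>, which complements that of \<open>g\<close> to 1.\<close>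
  define r where "r = \<beta> / (2 * s)"
  \<comment> \<open>The centroid of all \<open>n\<close> points relative to \<open>x k\<close>,
    which itself contributes 0; hence \<open>k\<close> terms but weight
    \<open>1 / N\<close>.\<close>
  define g where "g = (\<lambda>l. \<Sum>i<k. 1 / N * y i l)"
  define p where "p = (\<lambda>l. g l + r * w l)"
  have gram: "dot n (y i) (y j) = (if i = j then 1 else 1 / 2)" if "i < k" "j < k" for i j
    using equidistant_gram[of k n x i j] eq that by (simp add: y_def n)
  have g: "dot n g v = 1 / N * (\<Sum>i<k. dot n (y i) v)" for v
    unfolding g_def dot_sum_left dot_scale_left sum_distrib_left ..
  have yg: "dot n (y i) g = 1 / 2" if "i < k" for i
  proof -
    have "dot n (y i) g = 1 / N * (\<Sum>j<k. dot n (y j) (y i))"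
      by (simp only: dot_commute[of n "y i" g] g)
    also have "(\<Sum>j<k. dot n (y j) (y i)) = (\<Sum>j<k. 1 / 2 + (if j = i then 1 / 2 else 0))"
      using that by (intro sum.cong) (auto simp: gram)
    also have "\<dots> = of_nat k * (1 / 2) + 1 / 2"
      using that by (simp add: sum.distrib)
    also have "\<dots> = N / 2"
      using N by (simp add: field_simps)
    finally show ?thesis
      using N by simp
  qed
  have gg: "dot n g g = (N - 1) / (2 * N)"
    by (simp add: g[of g] yg N)
  have gw: "dot n g w = 0"
    using orth by (simp add: g y_def)
  have ww: "r\<^sup>2 * dot n w w = (N + 1) / (2 * N)"
  proof -
    have "dot n w w = s\<^sup>2 / N"
      using s(2) N by (simp add: N_def field_simps)
    then have "r\<^sup>2 * dot n w w = \<beta>\<^sup>2 / (4 * N)"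
      using s(1) by (simp add: r_def power_divide power_mult_distrib)
    also have "\<dots> = 2 * (N + 1) / (4 * N)"
      unfolding \<beta>[symmetric] N_def ..
    also have "\<dots> = (N + 1) / (2 * N)"
      using N by (simp add: frac_eq_eq algebra_simps)
    finally show ?thesis .
  qed
  have pp: "dot n p p = 1"
  proof -
    have "dot n p p = dot n g g + r\<^sup>2 * dot n w w"
      by (simp add: p_def dot_add_left dot_add_right dot_scale_left dot_scale_right gw
          dot_commute[of n w g] power2_eq_square)
    also have "\<dots> = ((N - 1) + (N + 1)) / (2 * N)"
      by (simp only: gg ww add_divide_distrib)
    also have "(N - 1) + (N + 1) = 2 * N"
      by simp
    finally show ?thesis
      using N by simp
  qed
  \<comment> \<open>The new point is \<open>x k + p\<close>: \<open>p\<close> has length 1 and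
    product 1/2 with every edge, like one more edge from \<open>x k\<close>.\<close>
  have "dot n (\<lambda>l. (x k l + p l) - x i l) (\<lambda>l. (x k l + p l) - x i l) = 1" if "i < n" for i
  proof (cases "i = k")
    case True
    then show ?thesis using pp by simp
  next
    case False
    then have i: "i < k" using that n by simp
    have yp: "2 * dot n (y i) p = 1"
      using orth[OF i] unfolding p_def dot_add_right dot_scale_right yg[OF i] by (simp add: y_def)
    have "(\<lambda>l. (x k l + p l) - x i l) = (\<lambda>l. p l - y i l)"
      by (simp add: y_def algebra_simps)
    then show ?thesis
      using pp yp gram[OF i i] by (simp add: dot_diff_left dot_diff_right dot_commute[of n p "y i"])
  qed
  from equidistant_SucI[OF eq this] show ?thesis by blast
qed

section \<open>Cliques\<close>

text \<open>Subsets of cliques are cliques, so excluding size \<open>m + 1\<close> excludes all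
  larger cliques, infinite ones included.\<close>

lemma clique_number_eqI:
  assumes C: "C \<subseteq> fst G" "clique C (snd G)" "finite C" "card C = m"
    and max: "\<And>C. C \<subseteq> fst G \<Longrightarrow> clique C (snd G) \<Longrightarrow> finite C \<Longrightarrow> card C \<noteq> Suc m"
  shows "clique_number G = enat m"
proof (rule antisym)
  show "clique_number G \<le> enat m"
    unfolding clique_number_def
  proof (rule SUP_least)
    fix D assume "D \<in> {C. C \<subseteq> fst G \<and> clique C (snd G)}"
    then have D: "D \<subseteq> fst G" "clique D (snd G)" by auto
    have no: False if "E \<subseteq> D" "finite E" "card E = Suc m" for E
      using max[of E] D that smaller_clique[of D "snd G" E] by auto
    show "(if finite D then enat (card D) else \<infinity>) \<le> enat m"
    proof (cases "finite D")
      case True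
      then have "\<not> Suc m \<le> card D"
        using no by (meson obtain_subset_with_card_n)
      then show ?thesis
        using True by simp
    next
      case False
      then show ?thesis
        using no infinite_arbitrarily_large[of D "Suc m"] by blast
    qed
  qed
  show "enat m \<le> clique_number G"
    unfolding clique_number_def using C by (intro SUP_upper2[of C]) auto
qed

lemma sum_of_squares_form_diff:
  assumes "u \<in> carrier_vec n" "v \<in> carrier_vec n"
  shows "sum_of_squares_form n (u - v) = dot n (\<lambda>l. u $ l - v $ l) (\<lambda>l. u $ l - v $ l)"
  using assms by (simp add: sum_of_squares_form_def diag_form_def dot_def power2_eq_square)

text \<open>The form is even, so an unordered edge determines its value on both differences.\<close>

lemma clique_sum_of_squares_iff:
  assumes C: "C \<subseteq> carrier_vec n"
  shows "clique C (snd (form_graph (carrier_vec n) (sum_of_squares_form n) a)) \<longleftrightarrow>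
    (\<forall>u\<in>C. \<forall>v\<in>C. u \<noteq> v \<longrightarrow> sum_of_squares_form n (u - v) = a)"
proof -
  have "sum_of_squares_form n (u - v) = sum_of_squares_form n (v - u)" if "u \<in> C" "v \<in> C" for u v
    using C that by (simp add: subset_iff sum_of_squares_form_diff dot_def algebra_simps)
  then have "{u, v} \<in> snd (form_graph (carrier_vec n) (sum_of_squares_form n) a) \<longleftrightarrow>
      sum_of_squares_form n (u - v) = a" if "u \<in> C" "v \<in> C" "u \<noteq> v" for u v
    using that C unfolding form_graph_def by (simp add: doubleton_eq_iff) blast
  then show ?thesis
    by (simp add: clique_def)
qed

lemma exists_clique_iff_equidistant:
  fixes n m :: nat
  defines "G \<equiv> form_graph (carrier_vec n :: 'a::field vec set) (sum_of_squares_form n) 1"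
  shows "(\<exists>C. C \<subseteq> fst G \<and> clique C (snd G) \<and> finite C \<and> card C = m) \<longleftrightarrow>
    (\<exists>x :: nat \<Rightarrow> nat \<Rightarrow> 'a. equidistant m n x)"
proof
  assume "\<exists>C. C \<subseteq> fst G \<and> clique C (snd G) \<and> finite C \<and> card C = m"
  then obtain C where C: "C \<subseteq> carrier_vec n" "clique C (snd G)" "finite C" "card C = m"
    by (auto simp: G_def form_graph_def)
  obtain f where f: "bij_betw f {0..<m} C"
    using ex_bij_betw_nat_finite[OF C(3)] C(4) by auto
  have "equidistant m n (\<lambda>i l. f i $ l)"
    unfolding equidistant_def
  proof (intro allI impI)
    fix i j assume "i < m" "j < m" "i \<noteq> j"
    then have "f i \<in> C" "f j \<in> C" "f i \<noteq> f j"
      using f by (auto simp: bij_betw_def inj_on_def)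
    then show "dot n (\<lambda>l. f i $ l - f j $ l) (\<lambda>l. f i $ l - f j $ l) = 1"
      using C(1,2) clique_sum_of_squares_iff[OF C(1)]
      by (auto simp: G_def sum_of_squares_form_diff[symmetric] subset_iff)
  qed
  then show "\<exists>x :: nat \<Rightarrow> nat \<Rightarrow> 'a. equidistant m n x" by blast
next
  assume "\<exists>x :: nat \<Rightarrow> nat \<Rightarrow> 'a. equidistant m n x"
  then obtain x :: "nat \<Rightarrow> nat \<Rightarrow> 'a" where x: "equidistant m n x" by blast
  let ?C = "(\<lambda>i. vec n (x i)) ` {..<m}"
  have q: "sum_of_squares_form n (vec n (x i) - vec n (x j)) = 1"
    if "i < m" "j < m" "i \<noteq> j" for i j
    using x that by (simp add: sum_of_squares_form_diff equidistant_def) (simp add: dot_def)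
  have "inj_on (\<lambda>i. vec n (x i)) {..<m}"
  proof (rule inj_onI, rule ccontr)
    fix i j assume ij: "i \<in> {..<m}" "j \<in> {..<m}" "vec n (x i) = vec n (x j)" "i \<noteq> j"
    have "x i l = x j l" if "l < n" for l
      using arg_cong[OF ij(3), of "\<lambda>v. v $ l"] that by simp
    then have "dot n (\<lambda>l. x i l - x j l) (\<lambda>l. x i l - x j l) = 0"
      by (simp add: dot_def)
    then show False
      using x ij by (simp add: equidistant_def)
  qed
  then have "card ?C = m"
    by (simp add: card_image)
  moreover have "clique ?C (snd G)"
    unfolding G_def by (subst clique_sum_of_squares_iff) (use q in auto)
  ultimately show "\<exists>C. C \<subseteq> fst G \<and> clique C (snd G) \<and> finite C \<and> card C = m"
    by (intro exI[of _ ?C]) (auto simp: G_def form_graph_def)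
qed

theorem theorem5p5:
  fixes n :: nat
  assumes "odd n" and "n > 0"
  shows "clique_number
           (form_graph (carrier_vec n :: 'a::field_char_0 vec set) (sum_of_squares_form n) 1) =
         (if (of_nat n :: 'a) \<notin> represented [1, 2 * (of_nat n - 1)] then enat (n - 1)
          else if (2 * (of_nat n + 1) :: 'a) \<notin> nonzero_squares then enat n
          else enat (n + 1))"
proof -
  let ?G = "form_graph (carrier_vec n :: 'a vec set) (sum_of_squares_form n) 1"
  let ?P = "\<lambda>m. \<exists>x :: nat \<Rightarrow> nat \<Rightarrow> 'a. equidistant m n x"
  have eqI: "clique_number ?G = enat m" if "?P m" "\<not> ?P (Suc m)" for m
  proof -
    obtain C where "C \<subseteq> fst ?G" "clique C (snd ?G)" "finite C" "card C = m"
      using \<open>?P m\<close> exists_clique_iff_equidistant[of n m, where 'a = 'a] by blast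
    then show ?thesis
      using \<open>\<not> ?P (Suc m)\<close> exists_clique_iff_equidistant[of n "Suc m", where 'a = 'a]
      by (intro clique_number_eqI) blast+
  qed
  have lower: "?P (n - 1)"
    using \<open>odd n\<close> equidistant_standard_points by (metis oddE Suc_eq_plus1 diff_Suc_1)
  \<comment> \<open>A circle of implications: an \<open>n\<close>-clique gives
    \<open>n = a^2 - 2 * b^2\<close>, this gives the representation, and the representation gives an
    \<open>n\<close>-clique.\<close>
  have full: "?P n \<longleftrightarrow> (of_nat n :: 'a) \<in> represented [1, 2 * (of_nat n - 1)]"
    using equidistant_full_norm_form[OF _ \<open>odd n\<close>] represented_of_norm_form[OF _ \<open>n > 0\<close>]
      exists_equidistant_full[OF \<open>odd n\<close>] represented_iff[of n, where 'a = 'a] by blast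
  have Suc: "?P (Suc n) \<longleftrightarrow> (2 * (of_nat n + 1) :: 'a) \<in> nonzero_squares" if "?P n"
    using that equidistant_Suc_dim_square[OF _ \<open>odd n\<close>] exists_equidistant_Suc[OF _ \<open>odd n\<close>] by blast
  have top: "\<not> ?P (Suc (Suc n))"
    using equidistant_le by blast
  show ?thesis
    using eqI[OF lower] eqI[of n] eqI[of "Suc n"] full Suc top \<open>n > 0\<close> by auto
qed

end
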